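(* Let $\Omega\subseteq\mathbb{R}^d$ be open, let $p(\cdot)\in\mathcal{P}$ with $p_+<\infty$ and $p(\cdot)\in LH_0$, and let $0<q\le\infty$. If there exists $x_0\in\Omega$ such that $p(x_0)=p_-$, then there exists $\varepsilon>0$ such that $$\mathcal{E}_{\mathsf G}^{L_{p(\cdot),q}}(t)\sim t^{-1/p_-},\qquad 0<t<\varepsilon,$$ i.e. there are constants $A,B>0$ with $A\,t^{-1/p_-}\le\mathcal{E}_{\mathsf G}^{L_{p(\cdot),q}}(t)\le B\,t^{-1/p_-}$ for all $0<t<\varepsilon$.
   Context: $\mu$ is Lebesgue measure on $\Omega$; $\chi_A$ is the characteristic function of $A$. For a measurable $p(\cdot):\Omega\to(0,\infty)$ put $p_-=\operatorname{ess\,inf}_{x\in\Omega}p(x)$, $p_+=\operatorname{ess\,sup}_{x\in\Omega}p(x)$. $\mathcal{P}$ is the set of such functions with $p_->0$ (exponent functions). Log-Hölder continuity: $r(\cdot)\in LH_0\{x_0\}$ (locally log-Hölder continuous at $x_0\in\Omega$) if there is $C_0>0$ with $|r(x)-r(x_0)|\le\frac{C_0}{-\log(|x-x_0|)}$ for all $x\in\Omega$ with $|x-x_0|<1/2$. $r(\cdot)\in LH_0$ if this holds for all $x_0\in\Omega$. Variable Lebesgue quasi-norm: $\|f\|_{p(\cdot)}=\inf\{\lambda>0:\int_\Omega(|f(x)|/\lambda)^{p(x)}\,dx\le1\}$. Variable Lorentz space $L_{p(\cdot),q}=L_{p(\cdot),q}(\Omega)$: the measurable $f:\Omega\to\mathbb{R}$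 with finite quasi-norm $$\|f\|_{L_{p(\cdot),q}}=\left(\int_0^\infty u^q\,\|\chi_{\{|f|>u\}}\|_{p(\cdot)}^q\,\frac{du}{u}\right)^{1/q}\ (0<q<\infty),\qquad \|f\|_{L_{p(\cdot),\infty}}=\sup_{u>0}u\,\|\chi_{\{|f|>u\}}\|_{p(\cdot)}.$$ Rearrangement: $f^*(t)=\inf\{s>0:\mu(\{|f|>s\})\le t\}$, $t\ge0$ (with $\inf\emptyset=\infty$). Growth envelope function of a quasi-normed function space $X$ on $\Omega$: $\mathcal{E}_{\mathsf G}^X(t)=\sup\{f^*(t):\|f\|_X\le1\}$, $t>0$. *)

theory Defs
  imports "HOL-Analysis.Analysis" "HOL-Probability.Essential_Supremum"
begin

text \<open>
  Throughout, \<open>\<Omega>\<close> is a subset of a Euclidean space and carries the measure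
  \<^term>\<open>lebesgue_on \<Omega>\<close>; functions on \<open>\<Omega>\<close> are total functions whose values outside \<open>\<Omega>\<close>
  are never used.
\<close>

(* Dual of the library's esssup, meant for measurable functions. *)
definition essinf :: "'a measure \<Rightarrow> ('a \<Rightarrow> ereal) \<Rightarrow> ereal" where
  "essinf M f = Liminf (ae_filter M) f"

lemma essinf_eq_AE: "essinf M f = Sup {z. AE x in M. z \<le> f x}"
  unfolding essinf_def Liminf_def
proof (intro antisym SUP_least Sup_least; clarsimp)
  fix P assume P: "AE x in M. P x"
  show "(INF x\<in>Collect P. f x) \<le> Sup {z. AE x in M. z \<le> f x}"
    using P by (intro Sup_upper) (auto elim!: eventually_mono intro: INF_lower)
next
  fix y assume "AE x in M. y \<le> f x"
  then have "(\<lambda>x. y \<le> f x) \<in> {P. AE x in M. P x}" by simp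
  then show "y \<le> (SUP P\<in>{P. AE x in M. P x}. INF x\<in>Collect P. f x)"
    by (rule SUP_upper2) (auto intro: INF_greatest)
qed

definition exponent_minus :: "'a::euclidean_space set \<Rightarrow> ('a \<Rightarrow> real) \<Rightarrow> ereal" where
  "exponent_minus \<Omega> p = essinf (lebesgue_on \<Omega>) (\<lambda>x. ereal (p x))"

definition exponent_plus :: "'a::euclidean_space set \<Rightarrow> ('a \<Rightarrow> real) \<Rightarrow> ereal" where
  "exponent_plus \<Omega> p = esssup (lebesgue_on \<Omega>) (\<lambda>x. ereal (p x))"

definition exponent_functions :: "'a::euclidean_space set \<Rightarrow> ('a \<Rightarrow> real) set" where
  "exponent_functions \<Omega> =
     {p \<in> borel_measurable (lebesgue_on \<Omega>). (\<forall>x\<in>\<Omega>. 0 < p x) \<and> 0 < exponent_minus \<Omega> p}"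

(* For x = x0 the library's ln 0 = 0 and c / 0 = 0 make the bound 0 \<le> 0, which agrees with
   reading -log 0 as infinity. The constant C may depend on x0. *)
definition log_Hoelder_at :: "'a::euclidean_space set \<Rightarrow> 'a \<Rightarrow> ('a \<Rightarrow> real) \<Rightarrow> bool" where
  "log_Hoelder_at \<Omega> x0 r \<longleftrightarrow>
     (\<exists>C>0. \<forall>x\<in>\<Omega>. norm (x - x0) < 1/2 \<longrightarrow> \<bar>r x - r x0\<bar> \<le> C / (- ln (norm (x - x0))))"

definition log_Hoelder :: "'a::euclidean_space set \<Rightarrow> ('a \<Rightarrow> real) \<Rightarrow> bool" where
  "log_Hoelder \<Omega> r \<longleftrightarrow> (\<forall>x0\<in>\<Omega>. log_Hoelder_at \<Omega> x0 r)"

definition var_Lebesgue_norm ::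
  "'a::euclidean_space set \<Rightarrow> ('a \<Rightarrow> real) \<Rightarrow> ('a \<Rightarrow> real) \<Rightarrow> ennreal" where
  "var_Lebesgue_norm \<Omega> p f =
     (INF l\<in>{l::real. 0 < l \<and> (\<integral>\<^sup>+ x. ennreal ((\<bar>f x\<bar> / l) powr p x) \<partial>lebesgue_on \<Omega>) \<le> 1}.
        ennreal l)"

(* Real powers of extended nonnegative numbers, meant for exponents r > 0. *)
definition ennreal_rpow :: "ennreal \<Rightarrow> real \<Rightarrow> ennreal" where
  "ennreal_rpow a r = (if a = top then top else ennreal (enn2real a powr r))"

definition superlevel_set :: "'a set \<Rightarrow> ('a \<Rightarrow> real) \<Rightarrow> real \<Rightarrow> 'a set" where
  "superlevel_set \<Omega> f s = {x \<in> \<Omega>. s < \<bar>f x\<bar>}"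

definition var_Lorentz_norm ::
  "'a::euclidean_space set \<Rightarrow> ('a \<Rightarrow> real) \<Rightarrow> ennreal \<Rightarrow> ('a \<Rightarrow> real) \<Rightarrow> ennreal" where
  "var_Lorentz_norm \<Omega> p q f =
     (let N = (\<lambda>u::real. var_Lebesgue_norm \<Omega> p (indicator (superlevel_set \<Omega> f u))) in
      if q = top then (SUP u\<in>{0<..}. ennreal u * N u)
      else ennreal_rpow
             (\<integral>\<^sup>+ u\<in>{0<..}. (ennreal (u powr enn2real q) * ennreal_rpow (N u) (enn2real q)
                              * ennreal (1 / u)) \<partial>lborel)
             (1 / enn2real q))"

definition var_Lorentz_space ::
  "'a::euclidean_space set \<Rightarrow> ('a \<Rightarrow> real) \<Rightarrow> ennreal \<Rightarrow> ('a \<Rightarrow> real) set" where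
  "var_Lorentz_space \<Omega> p q =
     {f \<in> borel_measurable (lebesgue_on \<Omega>). var_Lorentz_norm \<Omega> p q f < top}"

definition rearrangement :: "'a::euclidean_space set \<Rightarrow> ('a \<Rightarrow> real) \<Rightarrow> real \<Rightarrow> ennreal" where
  "rearrangement \<Omega> f t =
     (INF s\<in>{s::real. 0 < s \<and> emeasure (lebesgue_on \<Omega>) (superlevel_set \<Omega> f s) \<le> ennreal t}.
        ennreal s)"

(* X is the underlying set of a function space on \<Omega> and N its quasi-norm. *)
definition growth_envelope ::
  "'a::euclidean_space set \<Rightarrow> ('a \<Rightarrow> real) set \<Rightarrow> (('a \<Rightarrow> real) \<Rightarrow> ennreal) \<Rightarrow> real \<Rightarrow> ennreal" where
  "growth_envelope \<Omega> X N t = (SUP f\<in>{f \<in> X. N f \<le> 1}. rearrangement \<Omega> f t)"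

end

theory Submission
  imports Defs
begin

text \<open>
  A set of measure more than \<open>t < 1\<close> has a characteristic function of norm at least
  \<open>t powr (1 / p\<^sub>-)\<close>, because \<open>p \<ge> p\<^sub>-\<close> almost everywhere; the weak-type estimate for the unit
  ball of the Lorentz space turns this into the upper bound. Conversely, \<open>p\<close> differs from
  \<open>p\<^sub>- = p x\<^sub>0\<close> by at most \<open>C / (- ln \<rho>)\<close> on the ball of radius \<open>\<rho>\<close> around \<open>x\<^sub>0\<close>, so
  \<open>\<rho> powr (p\<^sub>- - p x)\<close> is bounded there and the norm of the characteristic function of this ball
  is comparable to its measure to the power \<open>1 / p\<^sub>-\<close>. Normalised characteristic functions of
  balls of measure \<open>2t\<close> give the lower bound.
\<close>

section \<open>Essential infimum and quasi-norms of characteristic functions\<close>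

text \<open>The supremum in \<open>essinf_eq_AE\<close> is already reached along a sequence of
  almost-everywhere lower bounds, and a countable union of null sets is null.\<close>

lemma AE_essinf_le: "AE x in M. essinf M f \<le> f x"
proof -
  let ?A = "{z. AE x in M. z \<le> f x}"
  have "-\<infinity> \<in> ?A" by simp
  then have "?A \<noteq> {}" by blast
  then obtain g :: "nat \<Rightarrow> ereal" where g: "range g \<subseteq> ?A" "Sup ?A = (SUP i. g i)"
    using Sup_countable_SUP by metis
  have "AE x in M. \<forall>i. g i \<le> f x"
    using g(1) by (subst AE_all_countable) auto
  then show ?thesis
    unfolding essinf_eq_AE g(2) by (rule eventually_mono) (blast intro: SUP_least)
qed

lemma var_Lebesgue_norm_le:
  assumes "0 < l" "(\<integral>\<^sup>+ x. ennreal ((\<bar>f x\<bar> / l) powr p x) \<partial>lebesgue_on \<Omega>) \<le> 1"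
  shows "var_Lebesgue_norm \<Omega> p f \<le> ennreal l"
  unfolding var_Lebesgue_norm_def using assms by (intro INF_lower) auto

lemma var_Lebesgue_norm_indicator_empty: "var_Lebesgue_norm \<Omega> p (indicator {}) = 0"
proof -
  have "var_Lebesgue_norm \<Omega> p (indicator {}) \<le> 0 + ennreal e" if "0 < e" for e
    \<comment> \<open>Every \<open>e > 0\<close> is admissible because \<open>0 powr p x\<close> is
      0 whatever \<open>p x\<close> is.\<close>
    using var_Lebesgue_norm_le[where f = "indicator {}" and l = e] that by simp
  then have "var_Lebesgue_norm \<Omega> p (indicator {}) \<le> 0"
    by (rule ennreal_le_epsilon)
  then show ?thesis by simp
qed

text \<open>For an admissible \<open>l < 1\<close>, \<open>P \<le> p x\<close> gives
  \<open>(1 / l) powr p x \<ge> l powr - P\<close> on \<open>E\<close>, so the modular is at least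
  \<open>l powr - P * t\<close>; being at most 1, it forces \<open>t \<le> l powr P\<close>. For
  \<open>l \<ge> 1\<close> the bound is immediate from \<open>t < 1\<close>.\<close>

lemma var_Lebesgue_norm_indicator_ge:
  assumes E: "E \<in> sets (lebesgue_on \<Omega>)" and p: "AE x in lebesgue_on \<Omega>. P \<le> p x" and P: "0 < P"
    and t: "0 < t" "t < 1" "ennreal t \<le> emeasure (lebesgue_on \<Omega>) E"
  shows "ennreal (t powr (1 / P)) \<le> var_Lebesgue_norm \<Omega> p (indicator E)"
  unfolding var_Lebesgue_norm_def
proof (rule INF_greatest, clarify)
  fix l :: real
  assume l: "0 < l"
    and int: "(\<integral>\<^sup>+ x. ennreal ((\<bar>indicator E x\<bar> / l) powr p x) \<partial>lebesgue_on \<Omega>) \<le> 1"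
  have "t powr (1 / P) \<le> l"
  proof (cases "l < 1")
    case True
    have "ennreal (l powr - P * t) = ennreal (l powr - P) * ennreal t"
      using t l by (simp add: ennreal_mult)
    also have "\<dots> \<le> ennreal (l powr - P) * emeasure (lebesgue_on \<Omega>) E"
      using t by (intro mult_left_mono) auto
    also have "\<dots> = (\<integral>\<^sup>+ x. ennreal (l powr - P) * indicator E x \<partial>lebesgue_on \<Omega>)"
      using E by (simp add: nn_integral_cmult_indicator)
    also have "\<dots> \<le> (\<integral>\<^sup>+ x. ennreal ((\<bar>indicator E x\<bar> / l) powr p x) \<partial>lebesgue_on \<Omega>)"
    proof (rule nn_integral_mono_AE, use p in \<open>rule AE_mp\<close>, rule AE_I2, rule impI)
      fix x assume "P \<le> p x"
      then have "l powr - P \<le> l powr - p x" using l True by (intro powr_mono') auto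
      also have "l powr - p x = (1 / l) powr p x" using l by (simp add: powr_divide powr_minus_divide)
      finally show "ennreal (l powr - P) * indicator E x
          \<le> ennreal ((\<bar>indicator E x\<bar> / l) powr p x)"
        by (auto simp: indicator_def ennreal_leI)
    qed
    also have "\<dots> \<le> 1" by (rule int)
    finally have "l powr - P * t \<le> 1" by simp
    then have "t \<le> l powr P" using l by (simp add: powr_minus field_simps)
    then have "t powr (1 / P) \<le> (l powr P) powr (1 / P)"
      using t P by (intro powr_mono2) auto
    then show ?thesis using l P by (simp add: powr_powr)
  next
    case False
    have "t powr (1 / P) \<le> 1" using t P by (intro powr_le1) auto
    with False show ?thesis by simp
  qed
  then show "ennreal (t powr (1 / P)) \<le> ennreal l" by (rule ennreal_leI)
qed

text \<open>In \<open>l powr - p x = l powr - P * l powr (P - p x)\<close> the log-Hoelder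
  hypothesis bounds the second factor by \<open>exp (C * d / P)\<close>, independently of
  \<open>\<rho>\<close>. The measure of the ball is of order \<open>\<rho> powr d\<close>, which
  cancels against \<open>l powr P\<close> for \<open>l = K * \<rho> powr (d / P)\<close>.\<close>

lemma var_Lebesgue_norm_indicator_ball_le:
  fixes x0 :: "'a::euclidean_space"
  assumes \<rho>: "0 < \<rho>" "\<rho> < 1/2" and ball: "ball x0 \<rho> \<subseteq> \<Omega>" and P: "0 < P"
    and p: "AE x in lebesgue_on \<Omega>. P \<le> p x"
    and C: "0 \<le> C" "\<And>x. x \<in> \<Omega> \<Longrightarrow> norm (x - x0) < 1/2 \<Longrightarrow> p x - P \<le> C / (- ln (norm (x - x0)))"
  defines "d \<equiv> real DIM('a)"
  defines "K \<equiv> (1 + exp (C * d / P) * unit_ball_vol d) powr (1 / P)"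
  assumes \<Omega>: "\<Omega> \<in> sets lebesgue"
  shows "var_Lebesgue_norm \<Omega> p (indicator (ball x0 \<rho>)) \<le> ennreal (K * \<rho> powr (d / P))"
proof (rule var_Lebesgue_norm_le)
  define E where "E = exp (C * d / P)"
  define c where "c = unit_ball_vol d"
  have c: "0 \<le> c" by (simp add: c_def d_def)
  have E: "0 < E" by (simp add: E_def)
  have d: "0 < d" by (simp add: d_def)
  have Ec: "1 \<le> 1 + E * c" using c E by simp
  have K: "1 \<le> K" using Ec P unfolding K_def E_def[symmetric] c_def[symmetric]
    by (intro ge_one_powr_ge_zero) auto
  define l where "l = K * \<rho> powr (d / P)"
  have l: "0 < l" using K \<rho> by (simp add: l_def)
  then show "0 < K * \<rho> powr (d / P)" by (simp add: l_def)
  have ln\<rho>: "ln \<rho> < 0" using \<rho> by simp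
  have "ln l = ln K + d / P * ln \<rho>" using K \<rho> by (simp add: l_def ln_mult ln_powr)
  then have lnl: "- ln l \<le> d / P * (- ln \<rho>)" using K by simp
  have lP: "l powr P = (1 + E * c) * \<rho> powr d"
    using Ec P \<rho> by (simp add: l_def K_def E_def[symmetric] c_def[symmetric] powr_mult powr_powr)
  have ptw: "(1 / l) powr p x \<le> l powr - P * E" if x: "x \<in> ball x0 \<rho>" and px: "P \<le> p x" for x
  proof -
    have nx: "norm (x - x0) < \<rho>" using x by (simp add: dist_norm norm_minus_commute)
    have "p x - P \<le> C / (- ln (norm (x - x0)))" using nx \<rho> x ball by (intro C) auto
    also have "\<dots> \<le> C / (- ln \<rho>)"
    proof (cases "x = x0")
      \<comment> \<open>At the centre, \<open>ln 0 = 0\<close> and division by zero make the left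
        side 0, while the right side is nonnegative.\<close>
      case True
      then show ?thesis using C ln\<rho> by (simp add: divide_nonneg_neg)
    next
      case False
      then have "ln (norm (x - x0)) \<le> ln \<rho>" using nx by (intro ln_mono) auto
      then have "C / (- ln (norm (x - x0))) \<le> C / (- ln \<rho>)" using C ln\<rho>
        by (intro divide_left_mono mult_pos_pos) auto
      then show ?thesis .
    qed
    finally have diff: "(p x - P) * (- ln \<rho>) \<le> C" using ln\<rho> by (simp add: field_simps)
    \<comment> \<open>Passing from \<open>- ln l\<close> to a multiple of \<open>- ln \<rho>\<close>
      makes \<open>diff\<close> applicable; the exponent then stays below \<open>C * d / P\<close>
      however small \<open>\<rho>\<close> is.\<close>
    have "(p x - P) * (- ln l) \<le> (p x - P) * (d / P * (- ln \<rho>))"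
      using px lnl by (intro mult_left_mono) auto
    also have "\<dots> = d / P * ((p x - P) * (- ln \<rho>))" by simp
    also have "\<dots> \<le> d / P * C" using diff d P by (intro mult_left_mono) auto
    finally have "exp ((p x - P) * (- ln l)) \<le> E" by (simp add: E_def mult.commute)
    have "(1 / l) powr p x = l powr - p x" using l by (simp add: powr_divide powr_minus_divide)
    also have "\<dots> = l powr - P * l powr (P - p x)" using l by (simp flip: powr_add)
    also have "l powr (P - p x) = exp ((p x - P) * (- ln l))"
      using l by (simp add: powr_def algebra_simps)
    also have "l powr - P * \<dots> \<le> l powr - P * E"
      using \<open>exp ((p x - P) * (- ln l)) \<le> E\<close> by (intro mult_left_mono) auto
    finally show ?thesis .
  qed
  have "emeasure (lebesgue_on \<Omega>) (ball x0 \<rho>) = emeasure lborel (ball x0 \<rho>)"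
    using \<Omega> ball by (subst emeasure_restrict_space) auto
  also have "\<dots> = ennreal (c * \<rho> powr d)"
    using \<rho> by (simp add: emeasure_ball c_def d_def powr_realpow)
  finally have vol: "emeasure (lebesgue_on \<Omega>) (ball x0 \<rho>) = ennreal (c * \<rho> powr d)" .
  have meas: "ball x0 \<rho> \<in> sets (lebesgue_on \<Omega>)"
    using \<Omega> ball by (subst sets_restrict_space_iff) auto
  have "(\<integral>\<^sup>+ x. ennreal ((\<bar>indicator (ball x0 \<rho>) x\<bar> / l) powr p x) \<partial>lebesgue_on \<Omega>)
      \<le> (\<integral>\<^sup>+ x. ennreal (l powr - P * E) * indicator (ball x0 \<rho>) x \<partial>lebesgue_on \<Omega>)"
  proof (rule nn_integral_mono_AE, use p in \<open>rule AE_mp\<close>, rule AE_I2, rule impI)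
    fix x assume "P \<le> p x"
    then show "ennreal ((\<bar>indicator (ball x0 \<rho>) x\<bar> / l) powr p x)
        \<le> ennreal (l powr - P * E) * indicator (ball x0 \<rho>) x"
      using ptw[of x] by (auto simp: indicator_def intro!: ennreal_leI)
  qed
  also have "\<dots> = ennreal (l powr - P * E) * ennreal (c * \<rho> powr d)"
    using meas by (simp add: nn_integral_cmult_indicator vol)
  also have "\<dots> = ennreal ((E * c) * \<rho> powr d / (l powr P))"
    using E c l by (simp add: powr_minus field_simps flip: ennreal_mult)
  also have "\<dots> \<le> ennreal 1"
    \<comment> \<open>By \<open>lP\<close> the quotient is
      \<open>E * c / (1 + E * c)\<close>.\<close>
    unfolding lP using Ec \<rho> by (intro ennreal_leI) (simp add: divide_simps)
  finally show "(\<integral>\<^sup>+ x. ennreal ((\<bar>indicator (ball x0 \<rho>) x\<bar> / (K * \<rho> powr (d / P))) powr p x)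
      \<partial>lebesgue_on \<Omega>) \<le> 1"
    by (simp add: l_def)
qed

section \<open>Powers in \<open>ennreal\<close> and the unit ball of the Lorentz space\<close>

text \<open>Used with \<open>r = 1 / enn2real q\<close> to strip the outer root of the Lorentz
  quasi-norm when it is compared with 1.\<close>

lemma ennreal_rpow_le_one_iff: "0 < r \<Longrightarrow> ennreal_rpow a r \<le> 1 \<longleftrightarrow> a \<le> 1"
  using powr_mono2[of r _ 1] powr_less_mono2[of r 1]
  by (cases a) (force simp: ennreal_rpow_def top_unique simp flip: not_le)+

lemma ennreal_rpow_ennreal: "0 \<le> a \<Longrightarrow> ennreal_rpow (ennreal a) r = ennreal (a powr r)"
  by (simp add: ennreal_rpow_def)

lemma ennreal_rpow_mono: "0 \<le> r \<Longrightarrow> a \<le> b \<Longrightarrow> ennreal_rpow a r \<le> ennreal_rpow b r"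
  by (cases a; cases b) (auto simp: ennreal_rpow_def top_unique intro!: ennreal_leI powr_mono2)

text \<open>This is the integral of \<open>u powr r\<close> against du/u; the possible singularity
  at 0 is integrable because \<open>r - 1 > -1\<close>.\<close>

lemma nn_integral_powr_from_0:
  fixes s r :: real
  assumes "0 < r" "0 \<le> s"
  shows "(\<integral>\<^sup>+ u\<in>{0..s}. ennreal (u powr (r - 1)) \<partial>lborel) = ennreal (s powr r / r)"
proof -
  have "(\<integral>\<^sup>+ u\<in>{0..s}. ennreal (u powr (r - 1)) \<partial>lborel)
      = (\<integral>\<^sup>+ u. ennreal (indicator {0..s} u * u powr (r - 1)) \<partial>lborel)"
    by (intro nn_integral_cong) (simp add: indicator_def)
  then show ?thesis
    using nn_integral_has_integral_lebesgue[OF _ has_integral_powr_from_0[of "r - 1" s]] assms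
    by (simp add: nn_integral_completion)
qed

lemma ennreal_powr_mult_one_divide:
  "0 < u \<Longrightarrow> ennreal (u powr r) * ennreal (1 / u) = ennreal (u powr (r - 1))" for u r :: real
  by (simp add: powr_diff flip: ennreal_mult)

text \<open>The reciprocal of the norm of \<open>\<lambda>u. u * indicator {0<..<1} u\<close> in \<open>L\<^sub>q(du / u)\<close>.\<close>

definition Lorentz_const :: "ennreal \<Rightarrow> real" where
  "Lorentz_const q = (if q = top then 1 else enn2real q powr (1 / enn2real q))"

lemma Lorentz_const_pos: "0 < q \<Longrightarrow> 0 < Lorentz_const q"
  by (cases q) (auto simp: Lorentz_const_def)

text \<open>For finite \<open>q = r\<close>, restricting the defining integral to
  \<open>{0..s}\<close> and bounding the norms there below by \<open>\<tau>\<close> gives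
  \<open>(s * \<tau>) powr r / r \<le> 1\<close>. For \<open>q = top\<close> the single level
  \<open>u = s\<close> suffices.\<close>

lemma var_Lorentz_norm_le_one_imp_weak_type:
  assumes q: "0 < q" and norm: "var_Lorentz_norm \<Omega> p q f \<le> 1" and s: "0 < s" and \<tau>: "0 < \<tau>"
    and ge: "\<And>u. 0 < u \<Longrightarrow> u \<le> s \<Longrightarrow>
      ennreal \<tau> \<le> var_Lebesgue_norm \<Omega> p (indicator (superlevel_set \<Omega> f u))"
  shows "s * \<tau> \<le> Lorentz_const q"
proof (cases q)
  case top
  have "ennreal (s * \<tau>)
      \<le> ennreal s * var_Lebesgue_norm \<Omega> p (indicator (superlevel_set \<Omega> f s))"
    using s \<tau> ge[of s] by (simp add: ennreal_mult mult_left_mono)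
  also have "\<dots> \<le> (SUP u\<in>{0<..}.
      ennreal u * var_Lebesgue_norm \<Omega> p (indicator (superlevel_set \<Omega> f u)))"
    using s by (intro SUP_upper) auto
  also have "\<dots> \<le> 1" using norm by (simp add: var_Lorentz_norm_def top)
  finally show ?thesis by (simp add: Lorentz_const_def top)
next
  case (real r)
  then have r: "0 < r" using q by simp
  let ?N = "\<lambda>u. var_Lebesgue_norm \<Omega> p (indicator (superlevel_set \<Omega> f u))"
  let ?I = "\<integral>\<^sup>+ u\<in>{0<..}. (ennreal (u powr r) * ennreal_rpow (?N u) r * ennreal (1 / u)) \<partial>lborel"
  have "ennreal (\<tau> powr r * (s powr r / r))
      = ennreal (\<tau> powr r) * (\<integral>\<^sup>+ u\<in>{0..s}. ennreal (u powr (r - 1)) \<partial>lborel)"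
    using s r by (simp add: nn_integral_powr_from_0 flip: ennreal_mult)
  also have "\<dots> = (\<integral>\<^sup>+ u. ennreal (\<tau> powr r) * (ennreal (u powr (r - 1)) * indicator {0..s} u) \<partial>lborel)"
    by (rule nn_integral_cmult[symmetric]) auto
  also have "\<dots> \<le> ?I"
  proof (intro nn_integral_mono)
    fix u :: real
    show "ennreal (\<tau> powr r) * (ennreal (u powr (r - 1)) * indicator {0..s} u)
      \<le> ennreal (u powr r) * ennreal_rpow (?N u) r * ennreal (1 / u) * indicator {0<..} u"
    proof (cases "0 < u \<and> u \<le> s")
      case True
      have "ennreal (\<tau> powr r) \<le> ennreal_rpow (?N u) r"
        using ennreal_rpow_mono[OF _ ge[of u], of r] True r \<tau> by (simp add: ennreal_rpow_ennreal)
      then have "ennreal (u powr r) * ennreal (1 / u) * ennreal (\<tau> powr r)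
          \<le> ennreal (u powr r) * ennreal (1 / u) * ennreal_rpow (?N u) r"
        by (intro mult_left_mono) auto
      moreover have "ennreal (u powr (r - 1)) = ennreal (u powr r) * ennreal (1 / u)"
        using True by (simp only: ennreal_powr_mult_one_divide)
      ultimately show ?thesis using True by (simp add: ac_simps)
    qed (auto simp: indicator_def)
  qed
  also have "?I \<le> 1"
    using norm real r by (simp add: var_Lorentz_norm_def ennreal_rpow_le_one_iff)
  finally have "(s * \<tau>) powr r \<le> r" using r s \<tau> by (simp add: powr_mult field_simps)
  then have "((s * \<tau>) powr r) powr (1 / r) \<le> r powr (1 / r)"
    using r by (intro powr_mono2) auto
  then show ?thesis using r s \<tau> real by (simp add: powr_powr Lorentz_const_def)
qed

text \<open>Counterpart of the weak-type estimate with the same constant: levels from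
  \<open>h\<close> on contribute nothing, so for finite \<open>q = r\<close> the integral is at most
  \<open>(h * l) powr r / r\<close>, which \<open>hl\<close> bounds by 1.\<close>

lemma var_Lorentz_norm_le_one:
  assumes q: "0 < q" and h: "0 < h" and l: "0 < l" and hl: "h * l \<le> Lorentz_const q"
    and le: "\<And>u. 0 < u \<Longrightarrow> u < h \<Longrightarrow>
      var_Lebesgue_norm \<Omega> p (indicator (superlevel_set \<Omega> f u)) \<le> ennreal l"
    and zero: "\<And>u. h \<le> u \<Longrightarrow> superlevel_set \<Omega> f u = {}"
  shows "var_Lorentz_norm \<Omega> p q f \<le> 1"
proof (cases q)
  case top
  have "ennreal u * var_Lebesgue_norm \<Omega> p (indicator (superlevel_set \<Omega> f u)) \<le> 1"
    if u: "0 < u" for u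
  proof (cases "u < h")
    case True
    have "ennreal u * var_Lebesgue_norm \<Omega> p (indicator (superlevel_set \<Omega> f u))
        \<le> ennreal h * ennreal l"
      using le[of u] u True by (intro mult_mono) (auto intro: ennreal_leI)
    also have "\<dots> = ennreal (h * l)" using h l by (simp add: ennreal_mult)
    also have "\<dots> \<le> 1" using hl by (simp add: Lorentz_const_def top)
    finally show ?thesis .
  qed (simp add: zero var_Lebesgue_norm_indicator_empty)
  then show ?thesis by (auto simp: var_Lorentz_norm_def top intro!: SUP_least)
next
  case (real r)
  then have r: "0 < r" using q by simp
  let ?N = "\<lambda>u. var_Lebesgue_norm \<Omega> p (indicator (superlevel_set \<Omega> f u))"
  let ?I = "\<integral>\<^sup>+ u\<in>{0<..}. (ennreal (u powr r) * ennreal_rpow (?N u) r * ennreal (1 / u)) \<partial>lborel"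
  have "?I \<le> (\<integral>\<^sup>+ u. ennreal (l powr r) * (ennreal (u powr (r - 1)) * indicator {0..h} u) \<partial>lborel)"
  proof (intro nn_integral_mono)
    fix u :: real
    show "ennreal (u powr r) * ennreal_rpow (?N u) r * ennreal (1 / u) * indicator {0<..} u
      \<le> ennreal (l powr r) * (ennreal (u powr (r - 1)) * indicator {0..h} u)"
    proof (cases "0 < u \<and> u < h")
      case True
      have "ennreal_rpow (?N u) r \<le> ennreal (l powr r)"
        using ennreal_rpow_mono[OF _ le[of u], of r] True r l by (simp add: ennreal_rpow_ennreal)
      then have "ennreal (u powr r) * ennreal (1 / u) * ennreal_rpow (?N u) r
          \<le> ennreal (u powr r) * ennreal (1 / u) * ennreal (l powr r)"
        by (intro mult_left_mono) auto
      moreover have "ennreal (u powr (r - 1)) = ennreal (u powr r) * ennreal (1 / u)"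
        using True by (simp only: ennreal_powr_mult_one_divide)
      ultimately show ?thesis using True by (simp add: ac_simps)
    next
      \<comment> \<open>Either \<open>u \<le> 0\<close>, outside the domain of integration, or
        \<open>h \<le> u\<close>, where the superlevel set is empty; the left side is 0 in both
        cases.\<close>
      case False
      then show ?thesis
        by (cases "0 < u")
          (simp_all add: zero var_Lebesgue_norm_indicator_empty ennreal_rpow_def)
    qed
  qed
  also have "\<dots> = ennreal (l powr r) * (\<integral>\<^sup>+ u\<in>{0..h}. ennreal (u powr (r - 1)) \<partial>lborel)"
    by (rule nn_integral_cmult) auto
  also have "\<dots> = ennreal ((h * l) powr r / r)"
    using h l r by (simp add: nn_integral_powr_from_0 powr_mult mult.commute[of "h powr r"]
        flip: ennreal_mult)
  also have "\<dots> \<le> ennreal 1"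
  proof (rule ennreal_leI)
    have "(h * l) powr r \<le> (r powr (1 / r)) powr r"
      using hl h l r real by (intro powr_mono2) (auto simp: Lorentz_const_def)
    then show "(h * l) powr r / r \<le> 1" using r by (simp add: powr_powr)
  qed
  finally show ?thesis using real r by (simp add: var_Lorentz_norm_def ennreal_rpow_le_one_iff)
qed

section \<open>Two-sided bounds for the growth envelope function\<close>

text \<open>If the superlevel set at height \<open>s\<close> has measure above \<open>t\<close>, so
  have all those at lower heights. Their norms are then at least \<open>t powr (1 / P)\<close>, and
  the weak-type estimate limits \<open>s\<close>.\<close>

lemma growth_envelope_var_Lorentz_le:
  assumes q: "0 < q" and p: "AE x in lebesgue_on \<Omega>. P \<le> p x" and P: "0 < P"
    and t: "0 < t" "t < 1"
  shows "growth_envelope \<Omega> (var_Lorentz_space \<Omega> p q) (var_Lorentz_norm \<Omega> p q) t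
    \<le> ennreal (Lorentz_const q * t powr (- 1 / P))"
  unfolding growth_envelope_def
proof (rule SUP_least, clarify)
  fix f assume f: "f \<in> var_Lorentz_space \<Omega> p q" and norm: "var_Lorentz_norm \<Omega> p q f \<le> 1"
  have meas [measurable]: "f \<in> borel_measurable (lebesgue_on \<Omega>)"
    using f by (simp add: var_Lorentz_space_def)
  have lev: "superlevel_set \<Omega> f u \<in> sets (lebesgue_on \<Omega>)" for u
  proof -
    have "superlevel_set \<Omega> f u = {x \<in> space (lebesgue_on \<Omega>). u < \<bar>f x\<bar>}"
      by (simp add: superlevel_set_def)
    also have "\<dots> \<in> sets (lebesgue_on \<Omega>)" by measurable
    finally show ?thesis .
  qed
  let ?b = "Lorentz_const q * t powr (- 1 / P)"
  have b: "0 < ?b" using Lorentz_const_pos[OF q] t by simp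
  have small: "emeasure (lebesgue_on \<Omega>) (superlevel_set \<Omega> f s) \<le> ennreal t" if s: "?b < s" for s
  proof (rule ccontr)
    assume "\<not> ?thesis"
    then have big: "ennreal t \<le> emeasure (lebesgue_on \<Omega>) (superlevel_set \<Omega> f s)" by simp
    have "s * t powr (1 / P) \<le> Lorentz_const q"
    proof (rule var_Lorentz_norm_le_one_imp_weak_type[OF q norm])
      fix u assume u: "0 < u" "u \<le> s"
      have "superlevel_set \<Omega> f s \<subseteq> superlevel_set \<Omega> f u"
        using u by (auto simp: superlevel_set_def)
      then have "ennreal t \<le> emeasure (lebesgue_on \<Omega>) (superlevel_set \<Omega> f u)"
        using big emeasure_mono[OF _ lev] order_trans by blast
      then show "ennreal (t powr (1 / P))
          \<le> var_Lebesgue_norm \<Omega> p (indicator (superlevel_set \<Omega> f u))"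
        by (rule var_Lebesgue_norm_indicator_ge[OF lev p P t])
    qed (use b s t in auto)
    then have "s \<le> ?b" using t by (simp add: powr_minus field_simps)
    with s show False by simp
  qed
  \<comment> \<open>The slack \<open>e\<close> is needed because \<open>small\<close> covers only
    heights strictly above \<open>?b\<close>.\<close>
  have "rearrangement \<Omega> f t \<le> ennreal ?b + ennreal e" if e: "0 < e" for e
  proof -
    have "rearrangement \<Omega> f t \<le> ennreal (?b + e)"
      unfolding rearrangement_def using b e small[of "?b + e"] by (intro INF_lower) auto
    then show ?thesis using b e by simp
  qed
  then show "rearrangement \<Omega> f t \<le> ennreal ?b" by (rule ennreal_le_epsilon)
qed

text \<open>The test function is a multiple of \<open>indicator B\<close>. As \<open>B\<close> has
  measure strictly above \<open>t\<close>, its rearrangement at \<open>t\<close> is at least the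
  height of that multiple.\<close>

lemma growth_envelope_var_Lorentz_ge:
  assumes q: "0 < q" and B: "B \<in> sets (lebesgue_on \<Omega>)" "ennreal t < emeasure (lebesgue_on \<Omega>) B"
    and l: "0 < l" "var_Lebesgue_norm \<Omega> p (indicator B) \<le> ennreal l"
  shows "ennreal (Lorentz_const q / l)
    \<le> growth_envelope \<Omega> (var_Lorentz_space \<Omega> p q) (var_Lorentz_norm \<Omega> p q) t"
proof -
  \<comment> \<open>With this height \<open>h * l = Lorentz_const q\<close>, the largest product
    that \<open>var_Lorentz_norm_le_one\<close> allows.\<close>
  define h where "h = Lorentz_const q / l"
  have h: "0 < h" using Lorentz_const_pos[OF q] l by (simp add: h_def)
  define f :: "'a \<Rightarrow> real" where "f = (\<lambda>x. h * indicator B x)"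
  have "B \<subseteq> \<Omega>" using sets.sets_into_space[OF B(1)] by simp
  then have lev: "superlevel_set \<Omega> f u = (if u < h then B else {})" if "0 < u" for u
    using that h by (auto simp: superlevel_set_def f_def indicator_def)
  have norm: "var_Lorentz_norm \<Omega> p q f \<le> 1"
    using h l lev by (intro var_Lorentz_norm_le_one[OF q h l(1)]) (auto simp: h_def)
  then have "var_Lorentz_norm \<Omega> p q f < top" using order_le_less_trans by fastforce
  moreover have "f \<in> borel_measurable (lebesgue_on \<Omega>)" unfolding f_def using B(1) by measurable
  ultimately have "f \<in> var_Lorentz_space \<Omega> p q" by (simp add: var_Lorentz_space_def)
  with norm have "rearrangement \<Omega> f t
      \<le> growth_envelope \<Omega> (var_Lorentz_space \<Omega> p q) (var_Lorentz_norm \<Omega> p q) t"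
    unfolding growth_envelope_def by (intro SUP_upper) auto
  moreover have "ennreal h \<le> rearrangement \<Omega> f t"
    unfolding rearrangement_def
  proof (rule INF_greatest, clarify)
    fix s :: real
    assume "0 < s" "emeasure (lebesgue_on \<Omega>) (superlevel_set \<Omega> f s) \<le> ennreal t"
    then have "h \<le> s" using lev[of s] B(2) by (auto split: if_splits)
    then show "ennreal h \<le> ennreal s" by (rule ennreal_leI)
  qed
  ultimately show ?thesis unfolding h_def by (rule order_trans[rotated])
qed

theorem corollary6p10:
  fixes \<Omega> :: "'a::euclidean_space set" and p :: "'a \<Rightarrow> real" and q :: ennreal
  assumes "open \<Omega>"
    and "p \<in> exponent_functions \<Omega>"
    and "exponent_plus \<Omega> p < \<infinity>"
    and "log_Hoelder \<Omega> p"
    and "0 < q"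
    and "\<exists>x0\<in>\<Omega>. ereal (p x0) = exponent_minus \<Omega> p"
  shows "\<exists>\<epsilon>>0. \<exists>A>0. \<exists>B>0. \<forall>t::real. 0 < t \<and> t < \<epsilon> \<longrightarrow>
     ennreal (A * t powr (- 1 / real_of_ereal (exponent_minus \<Omega> p)))
       \<le> growth_envelope \<Omega> (var_Lorentz_space \<Omega> p q) (var_Lorentz_norm \<Omega> p q) t \<and>
     growth_envelope \<Omega> (var_Lorentz_space \<Omega> p q) (var_Lorentz_norm \<Omega> p q) t
       \<le> ennreal (B * t powr (- 1 / real_of_ereal (exponent_minus \<Omega> p)))"
proof -
  from assms(6) obtain x0 where x0: "x0 \<in> \<Omega>" and Px: "exponent_minus \<Omega> p = ereal (p x0)"
    by metis
  define P where "P = p x0"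
  have P: "0 < P" using assms(2) x0 by (simp add: exponent_functions_def P_def)
  have real_P: "real_of_ereal (exponent_minus \<Omega> p) = P" by (simp add: Px P_def)
  have p: "AE x in lebesgue_on \<Omega>. P \<le> p x"
    using AE_essinf_le[of "lebesgue_on \<Omega>" "\<lambda>x. ereal (p x)"] Px
    by (simp add: exponent_minus_def P_def)
  obtain C where C: "0 < C"
    and CH: "\<And>x. x \<in> \<Omega> \<Longrightarrow> norm (x - x0) < 1/2 \<Longrightarrow> \<bar>p x - p x0\<bar> \<le> C / (- ln (norm (x - x0)))"
    using assms(4) x0 unfolding log_Hoelder_def log_Hoelder_at_def by blast
  obtain R0 where R0: "0 < R0" "ball x0 R0 \<subseteq> \<Omega>"
    using assms(1) x0 open_contains_ball by blast
  \<comment> \<open>Below this radius balls lie in \<open>\<Omega>\<close> and within the range of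
    the log-Hoelder condition.\<close>
  define R where "R = min R0 (1/2)"
  have R: "0 < R" "R \<le> 1/2" "R \<le> R0" using R0 by (auto simp: R_def)
  define d where "d = real DIM('a)"
  define c where "c = unit_ball_vol d"
  have d: "0 < d" by (simp add: d_def)
  have c: "0 < c" unfolding c_def d_def by (rule unit_ball_vol_pos) simp
  define K where "K = (1 + exp (C * d / P) * c) powr (1 / P)"
  have "0 < 1 + exp (C * d / P) * c" using c by (intro add_pos_pos) auto
  then have K: "0 < K" by (simp add: K_def)
  \<comment> \<open>The denominator is what remains of \<open>K * \<rho> powr (d / P)\<close> after
    extracting \<open>t powr (1 / P)\<close>, for the radius with
    \<open>\<rho> powr d = 2 * t / c\<close>.\<close>
  define A where "A = Lorentz_const q / (K * (2 / c) powr (1 / P))"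
  \<comment> \<open>The bound 1 serves the upper estimate; the other term guarantees
    \<open>\<rho> < R\<close> in the lower one.\<close>
  define \<epsilon> where "\<epsilon> = min 1 (c * R powr d / 2)"
  have A: "0 < A" using Lorentz_const_pos[OF assms(5)] K c by (simp add: A_def)
  have \<epsilon>: "0 < \<epsilon>" using c R by (simp add: \<epsilon>_def)
  have \<Omega>: "\<Omega> \<in> sets lebesgue" using assms(1) by simp
  have lower: "ennreal (A * t powr (- 1 / P))
      \<le> growth_envelope \<Omega> (var_Lorentz_space \<Omega> p q) (var_Lorentz_norm \<Omega> p q) t"
    if t: "0 < t" "t < \<epsilon>" for t
  proof -
    \<comment> \<open>The radius of a ball of measure \<open>2 * t\<close>; the factor 2 makes the
      measure strictly exceed \<open>t\<close>.\<close>
    define \<rho> where "\<rho> = (2 * t / c) powr (1 / d)"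
    have \<rho>0: "0 < \<rho>" using t c by (simp add: \<rho>_def)
    have \<rho>d: "\<rho> powr d = 2 * t / c" using t c d by (simp add: \<rho>_def powr_powr)
    also have "\<dots> < R powr d" using t c by (simp add: \<epsilon>_def field_simps)
    finally have "\<rho> < R" using \<rho>0 R d by (meson not_less powr_mono2 less_imp_le)
    then have \<rho>: "\<rho> < 1/2" "ball x0 \<rho> \<subseteq> \<Omega>" using R R0(2) by auto
    have meas: "ball x0 \<rho> \<in> sets (lebesgue_on \<Omega>)"
      using \<Omega> \<rho> by (subst sets_restrict_space_iff) auto
    have "emeasure (lebesgue_on \<Omega>) (ball x0 \<rho>) = emeasure lborel (ball x0 \<rho>)"
      using \<Omega> \<rho> by (subst emeasure_restrict_space) auto
    also have "\<dots> = ennreal (c * \<rho> powr d)"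
      using \<rho>0 by (simp add: emeasure_ball c_def d_def powr_realpow)
    also have "\<dots> = ennreal (2 * t)" using c \<rho>d by simp
    finally have vol: "ennreal t < emeasure (lebesgue_on \<Omega>) (ball x0 \<rho>)"
      using t by (simp add: ennreal_less_iff)
    have pP: "p x - P \<le> C / (- ln (norm (x - x0)))" if "x \<in> \<Omega>" "norm (x - x0) < 1/2" for x
      using CH[OF that] by (simp add: P_def)
    have "var_Lebesgue_norm \<Omega> p (indicator (ball x0 \<rho>)) \<le> ennreal (K * \<rho> powr (d / P))"
      using var_Lebesgue_norm_indicator_ball_le[OF \<rho>0 \<rho> P p less_imp_le[OF C] pP \<Omega>]
      by (simp add: K_def d_def c_def)
    moreover have "K * \<rho> powr (d / P) = K * (2 / c) powr (1 / P) * t powr (1 / P)"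
      using \<rho>d powr_powr[of \<rho> d "1 / P"] t c by (simp flip: powr_mult)
    ultimately have "ennreal (Lorentz_const q / (K * (2 / c) powr (1 / P) * t powr (1 / P)))
        \<le> growth_envelope \<Omega> (var_Lorentz_space \<Omega> p q) (var_Lorentz_norm \<Omega> p q) t"
      using K t c by (intro growth_envelope_var_Lorentz_ge[OF assms(5) meas vol]) auto
    then show ?thesis by (simp add: A_def powr_minus_divide)
  qed
  show ?thesis
    unfolding real_P
  proof (rule exI[of _ \<epsilon>], rule conjI[OF \<epsilon>], rule exI[of _ A], rule conjI[OF A],
      rule exI[of _ "Lorentz_const q"], rule conjI[OF Lorentz_const_pos[OF assms(5)]],
      intro allI impI conjI)
    fix t assume t: "0 < t \<and> t < \<epsilon>"
    then have "t < 1" by (simp add: \<epsilon>_def)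
    then show "growth_envelope \<Omega> (var_Lorentz_space \<Omega> p q) (var_Lorentz_norm \<Omega> p q) t
        \<le> ennreal (Lorentz_const q * t powr (- 1 / P))"
      using t by (intro growth_envelope_var_Lorentz_le[OF assms(5) p P]) auto
  qed (use lower in blast)
qed

end
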